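(* Let $X$ be a linearly ordered set with $|X|\geq 4$. Then there exists no transitive binary relation $\succeq$ on $\mathcal{X}=2^X\setminus\{\emptyset\}$ satisfying the Gärdenfors principle (GF), independence (IND) and simple uncertainty aversion (SUAv).
   Context: $X$ is linearly ordered by $\dot{\geq}$ (reflexive, complete, transitive, antisymmetric), with strict part $x\mathrel{\dot{>}}y$ iff $x\mathrel{\dot{\geq}}y$ and not $y\mathrel{\dot{\geq}}x$; $x\mathrel{\dot{<}}y$ means $y\mathrel{\dot{>}}x$. $\mathcal{X}=2^X\setminus\{\emptyset\}$ is the set of nonempty subsets of $X$. For a binary relation $\succeq$ on $\mathcal{X}$, $A\succ B$ means $A\succeq B$ and not $B\succeq A$; $A\prec B$ means $B\succ A$. The axioms are: - (GF) consists of both (GF1) and (GF2). (GF1): for all $x\in X$, $A\in\mathcal{X}$, if $x\mathrel{\dot{>}}a$ for all $a\in A$, then $A\cup\{x\}\succ A$. (GF2): for all $x\in X$, $A\in\mathcal{X}$, if $x\mathrel{\dot{<}}a$ for all $a\in A$, then $A\cup\{x\}\prec A$. - (IND) for all $A,B\in\mathcal{X}$ and all $x\in X\setminus(A\cup B)$: $A\succ B$ implies $A\cup\{x\}\succeq B\cup\{x\}$. - (SUAv) for all $x,y,z\in X$: $x\mathrel{\dot{>}}y$ and $y\mathrel{\dot{>}}z$ imply $\{y\}\succ\{x,z\}$. *)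

theory Defs
  imports Main
begin

text \<open>
  Binary relations are sets of pairs. A pair \<open>(x, y)\<close> in such a relation reads
  ``x is at least as good as y'', so the underlying order on the alternatives is given with the
  larger element first.
\<close>

definition strict :: "'b rel \<Rightarrow> 'b \<Rightarrow> 'b \<Rightarrow> bool" where
  "strict r x y \<longleftrightarrow> (x, y) \<in> r \<and> (y, x) \<notin> r"

definition nonempty_subsets :: "'a set \<Rightarrow> 'a set set" where
  "nonempty_subsets X = Pow X - {{}}"

definition GF1 :: "'a set \<Rightarrow> 'a rel \<Rightarrow> 'a set rel \<Rightarrow> bool" where
  "GF1 X r R \<longleftrightarrow>
    (\<forall>x\<in>X. \<forall>A\<in>nonempty_subsets X.
      (\<forall>a\<in>A. strict r x a) \<longrightarrow> strict R (A \<union> {x}) A)"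

definition GF2 :: "'a set \<Rightarrow> 'a rel \<Rightarrow> 'a set rel \<Rightarrow> bool" where
  "GF2 X r R \<longleftrightarrow>
    (\<forall>x\<in>X. \<forall>A\<in>nonempty_subsets X.
      (\<forall>a\<in>A. strict r a x) \<longrightarrow> strict R A (A \<union> {x}))"

definition GF :: "'a set \<Rightarrow> 'a rel \<Rightarrow> 'a set rel \<Rightarrow> bool" where
  "GF X r R \<longleftrightarrow> GF1 X r R \<and> GF2 X r R"

definition IND :: "'a set \<Rightarrow> 'a set rel \<Rightarrow> bool" where
  "IND X R \<longleftrightarrow>
    (\<forall>A\<in>nonempty_subsets X. \<forall>B\<in>nonempty_subsets X. \<forall>x\<in>X - (A \<union> B).
      strict R A B \<longrightarrow> (A \<union> {x}, B \<union> {x}) \<in> R)"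

definition SUAv :: "'a set \<Rightarrow> 'a rel \<Rightarrow> 'a set rel \<Rightarrow> bool" where
  "SUAv X r R \<longleftrightarrow>
    (\<forall>x\<in>X. \<forall>y\<in>X. \<forall>z\<in>X.
      strict r x y \<and> strict r y z \<longrightarrow> strict R {y} {x, z})"

end

theory Submission
  imports Defs
begin

text \<open>
  Take four alternatives \<open>a > b > c > d\<close>. Simple uncertainty aversion gives \<open>{b} \<succ> {a, c}\<close>, and the
  Gardenfors principle gives \<open>{c, d} \<succ> {d}\<close> and \<open>{a} \<succ> {a, b}\<close>. By independence,
  \<open>{b, d} \<succeq> {a, c, d} \<succeq> {a, d} \<succeq> {a, b, d}\<close>, whereas the Gardenfors principle yields
  \<open>{a, b, d} \<succ> {b, d}\<close>.
\<close>

lemma strict_trans: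
  assumes "trans r" "antisym r" "strict r x y" "strict r y z"
  shows "strict r x z"
  using assms unfolding strict_def by (metis antisymD transD)

text \<open>Induction on the set: a new element is compared with the greatest of the old ones, and
  the winner dominates the rest by transitivity.\<close>

lemma linear_order_on_finite_greatest:
  assumes "linear_order_on X r" "finite S" "S \<noteq> {}" "S \<subseteq> X"
  shows "\<exists>m\<in>S. \<forall>x\<in>S - {m}. strict r m x"
  using assms(2-4)
proof (induction S rule: finite_ne_induct)
  case (singleton x)
  then show ?case by simp
next
  case (insert x F)
  have r: "trans r" "antisym r" "total_on X r"
    using assms(1) by (auto simp: order_on_defs)
  from insert obtain m where m: "m \<in> F" "\<forall>y\<in>F - {m}. strict r m y" by auto
  \<comment> \<open>Since \<open>x\<close> lies outside \<open>F\<close>, it differs from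
    \<open>m\<close>; totality then compares the two, and antisymmetry makes the comparison
    strict.\<close>
  have "strict r x m \<or> strict r m x"
    using r insert.hyps insert.prems m(1)
    by (auto simp: strict_def total_on_def dest: antisymD)
  then show ?case
  proof
    assume "strict r x m"
    then have "\<forall>y\<in>F. strict r x y"
      using m by (metis \<open>strict r x m\<close> strict_trans[OF r(1,2)] Diff_iff singletonD)
    then show ?thesis by auto
  next
    assume "strict r m x"
    then show ?thesis using m by auto
  qed
qed

text \<open>A four-element subset is fixed and its greatest element removed three times; what is
  left over is the bottom of the chain.\<close>

lemma linear_order_on_chain4:
  assumes lin: "linear_order_on X r" and size: "infinite X \<or> card X \<ge> 4"
  obtains a b c d where "{a, b, c, d} \<subseteq> X" "strict r a b" "strict r b c" "strict r c d"
proof -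
  obtain S where S: "S \<subseteq> X" "finite S" "card S = 4"
    using size infinite_arbitrarily_large[of X 4] obtain_subset_with_card_n[of 4 X] by blast
  \<comment> \<open>Positive cardinality encodes finite and nonempty at once, so that the counts
    after each removal suffice below.\<close>
  have greatest: "\<exists>m\<in>T. \<forall>x\<in>T - {m}. strict r m x" if "T \<subseteq> S" "card T > 0" for T
    using that S linear_order_on_finite_greatest[OF lin, of T] card_gt_0_iff by blast
  obtain a where a: "a \<in> S" "\<forall>x\<in>S - {a}. strict r a x"
    using greatest[of S] S by auto
  have card_a: "card (S - {a}) = 3" using S a by simp
  obtain b where b: "b \<in> S - {a}" "\<forall>x\<in>S - {a} - {b}. strict r b x"
    using greatest[of "S - {a}"] card_a by auto
  have card_b: "card (S - {a} - {b}) = 2" using card_a b by simp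
  obtain c where c: "c \<in> S - {a} - {b}" "\<forall>x\<in>S - {a} - {b} - {c}. strict r c x"
    using greatest[of "S - {a} - {b}"] card_b by auto
  have "card (S - {a} - {b} - {c}) = 1" using card_b c by simp
  then obtain d where "d \<in> S - {a} - {b} - {c}" by (metis card_1_singletonE insertI1)
  then show thesis using that[of a b c d] S a b c by blast
qed

text \<open>With \<open>insert\<close> in place of a union, the result matches set literals whose
  first entry is the added alternative.\<close>

lemma strict_INDD:
  assumes "IND X R" "strict R A B" "A \<in> nonempty_subsets X" "B \<in> nonempty_subsets X"
    "x \<in> X" "x \<notin> A" "x \<notin> B"
  shows "(insert x A, insert x B) \<in> R"
  using assms unfolding IND_def by auto

theorem theorem4:
  fixes X :: "'a set" and r :: "'a rel"
  assumes "linear_order_on X r"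
    and "infinite X \<or> card X \<ge> 4"
  shows "\<not> (\<exists>R :: 'a set rel.
    R \<subseteq> nonempty_subsets X \<times> nonempty_subsets X \<and> trans R \<and>
    GF X r R \<and> IND X R \<and> SUAv X r R)"
proof
  assume "\<exists>R :: 'a set rel.
    R \<subseteq> nonempty_subsets X \<times> nonempty_subsets X \<and> trans R \<and>
    GF X r R \<and> IND X R \<and> SUAv X r R"
  then obtain R :: "'a set rel" where R: "trans R" "GF1 X r R" "GF2 X r R" "IND X R" "SUAv X r R"
    by (auto simp: GF_def)
  obtain a b c d where X: "{a, b, c, d} \<subseteq> X"
    and adj: "strict r a b" "strict r b c" "strict r c d"
    using linear_order_on_chain4[OF assms] .
  have r: "trans r" "antisym r"
    using assms(1) by (auto simp: order_on_defs)
  have ord: "strict r a c" "strict r b d" "strict r a d"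
    using adj strict_trans[OF r] by blast+
  have distinct: "a \<noteq> b" "a \<noteq> c" "a \<noteq> d" "b \<noteq> c" "b \<noteq> d" "c \<noteq> d"
    using adj ord by (auto simp: strict_def)
  have ne: "A \<in> nonempty_subsets X" if "A \<subseteq> {a, b, c, d}" "A \<noteq> {}" for A
    using that X by (auto simp: nonempty_subsets_def)
  have GF1: "strict R (A \<union> {x}) A"
    if "x \<in> X" "A \<in> nonempty_subsets X" "\<forall>y\<in>A. strict r x y" for x A
    using R(2) that by (simp add: GF1_def)
  have GF2: "strict R A (A \<union> {x})"
    if "x \<in> X" "A \<in> nonempty_subsets X" "\<forall>y\<in>A. strict r y x" for x A
    using R(3) that by (simp add: GF2_def)
  have "strict R {b} {a, c}"
    using R(5) X adj unfolding SUAv_def by blast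
  then have 1: "({d, b}, {d, a, c}) \<in> R"
    using strict_INDD[OF R(4), of "{b}" "{a, c}" d] ne X distinct by simp
  have "strict R {d, c} {d}"
    using GF1[of c "{d}"] ne X adj by (simp add: insert_commute)
  then have 2: "({d, a, c}, {d, a}) \<in> R"
    using strict_INDD[OF R(4), of "{d, c}" "{d}" a] ne X distinct by (simp add: insert_commute)
  have "strict R {a} {a, b}"
    using GF2[of b "{a}"] ne X adj by (simp add: insert_commute)
  then have 3: "({d, a}, {d, a, b}) \<in> R"
    using strict_INDD[OF R(4), of "{a}" "{a, b}" d] ne X distinct by simp
  have "({d, b}, {d, a, b}) \<in> R"
    using transD[OF R(1) transD[OF R(1) 1 2] 3] .
  \<comment> \<open>Independence yields only weak comparisons, so the contradiction rests on the
    strictness here: \<open>a\<close> exceeds both \<open>b\<close> and \<open>d\<close>, hence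
    adding it is a strict improvement.\<close>
  moreover have "strict R {d, a, b} {d, b}"
    using GF1[of a "{d, b}"] ne X adj ord by (simp add: insert_commute)
  ultimately show False by (simp add: strict_def)
qed

end
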